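(* Let $n\ge2$ and let $V$ and $W$ be closed $k$-gons in $\mathbb{R}^n$ that are in the discrete bicycle correspondence, i.e. $\mathcal{B}_\ell(V,W)$ holds for some $\ell>0$. Then, for every $\lambda>0$, the monodromies $M_{V,\lambda}$ and $M_{W,\lambda}$ are conjugate to each other (in the group of Möbius transformations of $S^{n-1}$).
   Context: A closed $k$-gon in $\mathbb{R}^n$ is a sequence of points $V_i$ with $V_{i+k}=V_i$ for all $i$. Discrete bicycle transport. Let $P,Q\in\mathbb{R}^n$, $\ell>0$, $\ell\ne|PQ|$, and let $X$ be a point with $|PX|=\ell$. Parallel translate $X$ along the vector $\overrightarrow{PQ}$ to $U=X+Q-P$ and reflect $U$ in the line $XQ$ (in the plane of $P,Q,X$) to obtain a point $Y$, the transport of $X$ along $PQ$; then $|QY|=\ell$ and $|XY|=|PQ|$. In terms of unit vectors $u=(X-P)/\ell$ and $v=(Y-Q)/\ell$ one has $v=\frac{2\,u\cdot\xi}{|\xi|^2}\,\xi-u$ with $\xi=(Q-P)-\ell u$. This defines a map $m_{PQ,\ell}:S^{n-1}\to S^{n-1}$, $u\mapsto v$. The discrete bicycle monodromy of a closed $k$-gon $V$ is $M_{V,\ell}=m_{V_kV_1,\ell}\circ\dots\circ m_{V_1V_2,\ell}$. It is a Möbius transformation of $S^{n-1}$. Discrete bicycle correspondence: $\mathcal{B}_\ell(V,W)$ means that for all $i$, $|V_iW_i|=\ell$ and $W_{i+1}$ is the transport of $W_i$ along $V_iV_{i+1}$. (Then $|W_iW_{i+1}|=|V_iV_{i+1}|$.)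 The length parameters $\ell$ and $\lambda$ are always taken different from all side lengths of the polygons, so that transports and monodromies are defined.
   Formalization: The formal theorem additionally assumes λ ≠ ℓ; at λ = ℓ the claim fails, e.g. for the triangle (0,0),(4,0),(1,6) traversed twice with ℓ = λ = 7, where M_V is the identity but M_W, for W_1 = (7,0), is not. *)

theory Defs
  imports "HOL-Analysis.Analysis" "HOL-Algebra.Bij" "HOL-Algebra.Generated_Groups"
begin

text \<open>A closed k-gon is a k-periodic sequence of points, with vertices V 1, ..., V k.\<close>

definition closed_polygon :: "nat \<Rightarrow> (nat \<Rightarrow> 'a) \<Rightarrow> bool" where
  "closed_polygon k V \<longleftrightarrow> k \<ge> 1 \<and> (\<forall>i. V (i + k) = V i)"

definition differs_from_sides :: "real \<Rightarrow> (nat \<Rightarrow> 'a::metric_space) \<Rightarrow> bool" where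
  "differs_from_sides l V \<longleftrightarrow> (\<forall>i. l \<noteq> dist (V i) (V (Suc i)))"

text \<open>Reflection of a point in the line through two distinct points A and B.\<close>

definition line_reflection :: "'a::real_inner \<Rightarrow> 'a \<Rightarrow> 'a \<Rightarrow> 'a" where
  "line_reflection A B U =
     A + (2 * ((U - A) \<bullet> (B - A)) / (norm (B - A))\<^sup>2) *\<^sub>R (B - A) - (U - A)"

definition bicycle_transport :: "'a::real_inner \<Rightarrow> 'a \<Rightarrow> 'a \<Rightarrow> 'a" where
  "bicycle_transport P Q X = line_reflection X Q (X + Q - P)"

definition bicycle_correspondence ::
    "real \<Rightarrow> (nat \<Rightarrow> 'a::real_inner) \<Rightarrow> (nat \<Rightarrow> 'a) \<Rightarrow> bool" where
  "bicycle_correspondence l V W \<longleftrightarrow>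
     (\<forall>i. dist (V i) (W i) = l \<and> W (Suc i) = bicycle_transport (V i) (V (Suc i)) (W i))"

definition transport_map :: "'a::real_inner \<Rightarrow> 'a \<Rightarrow> real \<Rightarrow> 'a \<Rightarrow> 'a" where
  "transport_map P Q l u =
     (let \<xi> = (Q - P) - l *\<^sub>R u in (2 * (u \<bullet> \<xi>) / (norm \<xi>)\<^sup>2) *\<^sub>R \<xi> - u)"

primrec iterated_transport :: "(nat \<Rightarrow> 'a::real_inner) \<Rightarrow> real \<Rightarrow> nat \<Rightarrow> 'a \<Rightarrow> 'a" where
  "iterated_transport V l 0 = id"
| "iterated_transport V l (Suc j) =
     transport_map (V (Suc j)) (V (Suc (Suc j))) l \<circ> iterated_transport V l j"

text \<open>
  The last factor uses V (k + 1), which is V 1 for a closed k-gon.  The map is restricted to the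
  unit sphere so as to be an element of a permutation group in the sense of \<^const>\<open>BijGroup\<close>.
\<close>

definition bicycle_monodromy :: "nat \<Rightarrow> (nat \<Rightarrow> 'a::real_inner) \<Rightarrow> real \<Rightarrow> 'a \<Rightarrow> 'a" where
  "bicycle_monodromy k V l = restrict (iterated_transport V l k) (sphere 0 1)"

definition inversion :: "'a::real_inner \<Rightarrow> real \<Rightarrow> 'a \<Rightarrow> 'a" where
  "inversion c r x = c + (r / norm (x - c))\<^sup>2 *\<^sub>R (x - c)"

definition hyperplane_reflection :: "'a::real_inner \<Rightarrow> 'a \<Rightarrow> 'a" where
  "hyperplane_reflection a x = x - (2 * (x \<bullet> a) / (norm a)\<^sup>2) *\<^sub>R a"

text \<open>
  The inversions of the unit sphere S in its codimension-one subspheres.  Such a subsphere is the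
  intersection of S with a sphere orthogonal to S, that is, with centre c and radius r such that
  the squared norm of c is 1 + r^2, or with a hyperplane through the origin.
\<close>

definition sphere_inversions :: "('a::real_inner \<Rightarrow> 'a) set" where
  "sphere_inversions =
     {restrict (inversion c r) (sphere 0 1) | c r. r > 0 \<and> (norm c)\<^sup>2 = 1 + r\<^sup>2}
     \<union> {restrict (hyperplane_reflection a) (sphere 0 1) | a. a \<noteq> 0}"

definition moebius_group :: "('a::real_inner \<Rightarrow> 'a) monoid" where
  "moebius_group =
     (BijGroup (sphere 0 1)) \<lparr>carrier := generate (BijGroup (sphere 0 1)) sphere_inversions\<rparr>"

definition conjugate_in :: "('g, 'm) monoid_scheme \<Rightarrow> 'g \<Rightarrow> 'g \<Rightarrow> bool" where
  "conjugate_in G f g \<longleftrightarrow> f \<in> carrier G \<and> g \<in> carrier G \<and>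
     (\<exists>h \<in> carrier G. g = h \<otimes>\<^bsub>G\<^esub> f \<otimes>\<^bsub>G\<^esub> inv\<^bsub>G\<^esub> h)"

lemma bicycle_transport_eq_transport_map:
  "bicycle_transport P Q (P + l *\<^sub>R u) = Q + l *\<^sub>R transport_map P Q l u"
  if "Q \<noteq> P + l *\<^sub>R u"
proof -
  define d where "d = Q - P - l *\<^sub>R u"
  have d: "(norm d)\<^sup>2 \<noteq> 0" using that by (auto simp: d_def algebra_simps)
  have Q: "Q = P + l *\<^sub>R u + d" by (simp add: d_def)
  have n: "(norm d)\<^sup>2 = d \<bullet> d" by (simp add: power2_norm_eq_inner)
  have "2 * ((l *\<^sub>R u + d) \<bullet> d) / (norm d)\<^sup>2 = 2 + l * (2 * (u \<bullet> d) / (norm d)\<^sup>2)"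
    using d by (simp add: n field_simps inner_add_left)
  then show ?thesis
    unfolding bicycle_transport_def line_reflection_def transport_map_def Let_def
    by (simp add: Q algebra_simps scaleR_2)
qed

lemma norm_transport_map: "norm (transport_map P Q l u) = norm u"
proof -
  define d where "d = Q - P - l *\<^sub>R u"
  define c where "c = 2 * (u \<bullet> d) / (norm d)\<^sup>2"
  have "c * (c * (d \<bullet> d)) = c * (2 * (u \<bullet> d))"
    by (cases "d = 0") (simp_all add: c_def power2_norm_eq_inner)
  then have "(norm (c *\<^sub>R d - u))\<^sup>2 = (norm u)\<^sup>2"
    unfolding power2_norm_eq_inner
    by (simp add: inner_diff_left inner_diff_right inner_commute algebra_simps)
  then show ?thesis
    by (simp add: transport_map_def Let_def d_def c_def)
qed

lemma sphere_inversions_subset_Bij: "sphere_inversions \<subseteq> Bij (sphere (0::'a::real_inner) 1)"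
proof -
  let ?S = "sphere (0::'a) 1"
  have involution: "restrict f ?S \<in> Bij ?S"
    if "\<And>x. x \<in> ?S \<Longrightarrow> f x \<in> ?S" "\<And>x. x \<in> ?S \<Longrightarrow> f (f x) = x" for f
    unfolding Bij_def using that by (auto intro!: bij_betw_byWitness[where f' = f])
  have 1: "restrict (inversion c r) ?S \<in> Bij ?S" if r: "r > 0" and c: "(norm c)\<^sup>2 = 1 + r\<^sup>2" for c r
  proof (rule involution)
    fix x :: 'a assume "x \<in> ?S"
    then have x: "x \<bullet> x = 1" by (simp add: norm_eq_1)
    define y where "y = x - c"
    have "x \<noteq> c" using x c r by (auto simp: power2_norm_eq_inner)
    then have y: "y \<noteq> 0" by (simp add: y_def)
    have cc: "c \<bullet> c = 1 + r\<^sup>2" using c by (simp add: power2_norm_eq_inner)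
    have "y \<bullet> y + 2 * (c \<bullet> y) = x \<bullet> x - c \<bullet> c"
      by (simp add: y_def algebra_simps inner_commute inner_diff_left inner_diff_right)
    then have cy: "2 * (c \<bullet> y) = - r\<^sup>2 - y \<bullet> y" using x cc by simp
    define t where "t = r\<^sup>2 / (y \<bullet> y)"
    have inv: "inversion c r x = c + t *\<^sub>R y"
      by (simp add: inversion_def y_def t_def power_divide power2_norm_eq_inner)
    have ty: "t * (y \<bullet> y) = r\<^sup>2" using y by (simp add: t_def)
    have "(c + t *\<^sub>R y) \<bullet> (c + t *\<^sub>R y) = c \<bullet> c + t * (2 * (c \<bullet> y)) + t * (t * (y \<bullet> y))"
      by (simp add: inner_add_left inner_add_right inner_commute algebra_simps)
    also have "\<dots> = 1 + r\<^sup>2 + t * (- r\<^sup>2 - y \<bullet> y) + t * r\<^sup>2"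
      by (simp only: cc cy ty)
    also have "\<dots> = 1" using ty by (simp add: algebra_simps)
    finally show "inversion c r x \<in> ?S" by (simp add: inv norm_eq_1)
    have t: "t > 0" using r y by (simp add: t_def)
    have "(r / norm (t *\<^sub>R y))\<^sup>2 * t = 1"
      using t ty y by (simp add: power_divide power_mult_distrib power2_norm_eq_inner)
        (simp add: power2_eq_square field_simps)
    then show "inversion c r (inversion c r x) = x"
      unfolding inv by (simp add: inversion_def y_def)
  qed
  have 2: "restrict (hyperplane_reflection a) ?S \<in> Bij ?S" if "a \<noteq> 0" for a
  proof (rule involution)
    fix x :: 'a assume "x \<in> ?S"
    then have x: "x \<bullet> x = 1" by (simp add: norm_eq_1)
    define t where "t = 2 * (x \<bullet> a) / (norm a)\<^sup>2"
    have t: "t * (a \<bullet> a) = 2 * (x \<bullet> a)" using that by (simp add: t_def power2_norm_eq_inner)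
    have refl: "hyperplane_reflection a x = x - t *\<^sub>R a"
      by (simp add: hyperplane_reflection_def t_def)
    have "(x - t *\<^sub>R a) \<bullet> (x - t *\<^sub>R a) = x \<bullet> x - t * (2 * (x \<bullet> a)) + t * (t * (a \<bullet> a))"
      by (simp add: inner_diff_left inner_diff_right inner_commute algebra_simps)
    then show "hyperplane_reflection a x \<in> ?S" by (simp add: refl norm_eq_1 t x)
    have "2 * ((x - t *\<^sub>R a) \<bullet> a) / (norm a)\<^sup>2 = - t"
      using t that by (simp add: inner_diff_left t_def power2_norm_eq_inner field_simps)
    then show "hyperplane_reflection a (hyperplane_reflection a x) = x"
      unfolding refl by (simp add: hyperplane_reflection_def)
  qed
  show ?thesis unfolding sphere_inversions_def using 1 2 by blast
qed

lemma group_moebius_group: "group (moebius_group :: ('a::real_inner \<Rightarrow> 'a) monoid)"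
proof -
  interpret group "BijGroup (sphere (0::'a) 1)" by (rule group_BijGroup)
  have "sphere_inversions \<subseteq> carrier (BijGroup (sphere (0::'a) 1))"
    using sphere_inversions_subset_Bij by (simp add: BijGroup_def)
  then show ?thesis
    unfolding moebius_group_def by (intro subgroup_imp_group generate_is_subgroup)
qed

end

theory Submission
  imports Defs
begin

text \<open>
  The monodromies are conjugated by the transport along the segment from \<open>V 1\<close> to \<open>W 1\<close>.  Indeed
  one step of the correspondence is a quadrilateral with vertices \<open>P = V i\<close>, \<open>Q = V (i + 1)\<close>,
  \<open>Y = W (i + 1)\<close>, \<open>X = W i\<close>, and the point is that transport from \<open>P\<close> to the opposite vertex
  \<open>Y\<close> gives the same result through \<open>Q\<close> as through \<open>X\<close>, for every length parameter \<open>\<mu>\<close>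
  that differs from the side lengths of the quadrilateral (lemma \<open>transport_map_commuting_square\<close>).
  Such commuting squares, placed next to each other along the polygons, show that
  transporting along \<open>V\<close> and then across to \<open>W\<close> is the same as transporting across and then
  along \<open>W\<close>.  After a full turn both crossings are the same map, by periodicity.

  To see that a square commutes, view the unit sphere as the projectivized light cone of the
  space of pairs \<open>(u, t)\<close> with the form \<open>u \<bullet> u - t\<^sup>2\<close>.  Transport along a vector \<open>a\<close> is then
  induced by a linear map whose entries are quadratic in \<open>a\<close> and \<open>\<mu>\<close>
  (lemma \<open>transport_lift_eq\<close>), and for a quadrilateral of the above kind the two products of
  linear maps coincide exactly (lemma \<open>transport_lift_butterfly\<close>).  This is a polynomial identity:
  the quadrilateral is planar with parallel diagonals, \<open>Y - P = \<kappa> *\<^sub>R (X - Q)\<close>, so \<open>Y - Q\<close> and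
  \<open>Y - X\<close> are combinations of \<open>a = Q - P\<close> and \<open>x = X - P\<close> whose coefficients depend on \<open>\<kappa>\<close>
  alone, and the equality of opposite sides is one relation between \<open>\<kappa>\<close> and the inner products
  of \<open>a\<close> and \<open>x\<close>.

  It remains to see that transports are Moebius transformations.  Put \<open>c = a / \<mu>\<close>.  If
  \<open>norm c > 1\<close>, transport is the inversion centred at \<open>c\<close> followed by the antipodal map, which is
  a product of reflections in coordinate hyperplanes.  If \<open>0 < norm c < 1\<close>, it is the inversion
  centred at the inverse point \<open>c / (norm c)\<^sup>2\<close> followed by the reflection in the hyperplane
  orthogonal to \<open>c\<close>.  For \<open>c = 0\<close> it is the identity.
\<close>

section \<open>Transport as a linear map of the light cone\<close>

text \<open>
  For unit vectors \<open>u\<close>, both the squared norm of \<open>a - \<mu> *\<^sub>R u\<close> and its product with the transport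
  of \<open>u\<close> are affine functions of \<open>u\<close>: the quadratic terms cancel.  The coordinate \<open>t\<close> makes them
  linear.
\<close>

definition transport_lift :: "real \<Rightarrow> 'a::real_inner \<Rightarrow> 'a \<times> real \<Rightarrow> 'a \<times> real" where
  "transport_lift \<mu> a z =
     ((2 * (a \<bullet> fst z - \<mu> * snd z)) *\<^sub>R a + (\<mu>\<^sup>2 - a \<bullet> a) *\<^sub>R fst z,
      (a \<bullet> a + \<mu>\<^sup>2) * snd z - 2 * \<mu> * (a \<bullet> fst z))"

lemma transport_lift_scaleR: "transport_lift \<mu> a (r *\<^sub>R z) = r *\<^sub>R transport_lift \<mu> a z"
  by (simp add: transport_lift_def prod_eq_iff algebra_simps)

lemma transport_denominator_nonzero:
  fixes a u :: "'a::real_inner"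
  assumes "norm u = 1" and "\<mu> > 0" and "norm a \<noteq> \<mu>"
  shows "(norm (a - \<mu> *\<^sub>R u))\<^sup>2 \<noteq> 0"
  using assms by auto

lemma transport_denominator_expand:
  fixes a u :: "'a::real_inner"
  assumes "norm u = 1"
  shows "(norm (a - \<mu> *\<^sub>R u))\<^sup>2 = a \<bullet> a + \<mu>\<^sup>2 - 2 * \<mu> * (a \<bullet> u)"
proof -
  have "u \<bullet> u = 1" using assms by (simp add: norm_eq_1)
  then show ?thesis
    unfolding power2_norm_eq_inner
    by (simp add: inner_diff_left inner_diff_right inner_commute power2_eq_square algebra_simps)
qed

lemma transport_lift_eq:
  fixes u :: "'a::real_inner"
  assumes u: "norm u = 1" and "\<mu> > 0" and "dist P Q \<noteq> \<mu>"
  shows "transport_lift \<mu> (Q - P) (u, 1) =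
    (norm ((Q - P) - \<mu> *\<^sub>R u))\<^sup>2 *\<^sub>R (transport_map P Q \<mu> u, 1)"
proof -
  define a where "a = Q - P"
  define D where "D = (norm (a - \<mu> *\<^sub>R u))\<^sup>2"
  have D0: "D \<noteq> 0"
    unfolding D_def using assms
    by (intro transport_denominator_nonzero) (auto simp: a_def dist_norm norm_minus_commute)
  have D: "D = a \<bullet> a + \<mu>\<^sup>2 - 2 * \<mu> * (a \<bullet> u)"
    unfolding D_def using u by (rule transport_denominator_expand)
  have "u \<bullet> u = 1" using u by (simp add: norm_eq_1)
  then have num: "u \<bullet> (a - \<mu> *\<^sub>R u) = a \<bullet> u - \<mu>"
    by (simp add: inner_diff_right inner_commute)
  have "D *\<^sub>R transport_map P Q \<mu> u = (2 * (a \<bullet> u - \<mu>)) *\<^sub>R (a - \<mu> *\<^sub>R u) - D *\<^sub>R u"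
    using D0 by (simp add: transport_map_def Let_def num scaleR_diff_right
        flip: a_def D_def)
  also have "\<dots> = (2 * (a \<bullet> u - \<mu>)) *\<^sub>R a + (- (2 * (a \<bullet> u - \<mu>) * \<mu>) - D) *\<^sub>R u"
    by (simp add: algebra_simps)
  also have "- (2 * (a \<bullet> u - \<mu>) * \<mu>) - D = \<mu>\<^sup>2 - a \<bullet> a"
    by (simp add: D algebra_simps power2_eq_square)
  finally show ?thesis
    by (simp add: transport_lift_def D prod_eq_iff flip: a_def D_def)
qed

section \<open>Commuting squares\<close>

text \<open>
  The two routes \<open>a + y\<close> and \<open>x + c\<close> have the same end point, and the hypothesis \<open>rel\<close> says
  exactly that opposite sides, \<open>y\<close> and \<open>x\<close> as well as \<open>c\<close> and \<open>a\<close>, have equal lengths.  Once \<open>y\<close>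
  and \<open>c\<close> are expressed by \<open>a\<close> and \<open>x\<close>, comparing the coefficients of \<open>a\<close>, \<open>x\<close> and \<open>u\<close> and the
  last coordinates leaves polynomial identities that hold modulo this one relation.
\<close>

lemma transport_lift_butterfly:
  fixes a x y c :: "'a::real_inner"
  assumes rel: "\<kappa> * (a \<bullet> a + x \<bullet> x - 2 * (a \<bullet> x)) = x \<bullet> x - a \<bullet> a"
    and y: "y = \<kappa> *\<^sub>R x - (1 + \<kappa>) *\<^sub>R a"
    and c: "c = (\<kappa> - 1) *\<^sub>R x - \<kappa> *\<^sub>R a"
  shows "transport_lift \<mu> y (transport_lift \<mu> a z) = transport_lift \<mu> c (transport_lift \<mu> x z)"
proof -
  obtain u t where z: "z = (u, t)" by (cases z)
  define \<alpha> \<beta> p A X where "\<alpha> = a \<bullet> a" and "\<beta> = x \<bullet> x" and "p = a \<bullet> x"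
    and "A = a \<bullet> u" and "X = x \<bullet> u"
  note abbrev = \<alpha>_def[symmetric] \<beta>_def[symmetric] p_def[symmetric] A_def[symmetric] X_def[symmetric]
  have r: "\<kappa> * (\<alpha> + \<beta> - 2 * p) = \<beta> - \<alpha>" using rel by (simp add: abbrev)
  have xa: "x \<bullet> a = p" by (simp add: p_def inner_commute)
  have "y \<bullet> y = \<kappa>\<^sup>2 * \<beta> - 2 * \<kappa> * (1 + \<kappa>) * p + (1 + \<kappa>)\<^sup>2 * \<alpha>"
    by (simp add: y inner_diff_left inner_diff_right abbrev xa power2_eq_square algebra_simps)
  then have yy: "y \<bullet> y = \<beta>" using r by algebra
  have "c \<bullet> c = (\<kappa> - 1)\<^sup>2 * \<beta> - 2 * \<kappa> * (\<kappa> - 1) * p + \<kappa>\<^sup>2 * \<alpha>"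
    by (simp add: c inner_diff_left inner_diff_right abbrev xa power2_eq_square algebra_simps)
  then have cc: "c \<bullet> c = \<alpha>" using r by algebra
  have ya: "y \<bullet> a = \<kappa> * p - (1 + \<kappa>) * \<alpha>" and yu: "y \<bullet> u = \<kappa> * X - (1 + \<kappa>) * A"
    and cx: "c \<bullet> x = (\<kappa> - 1) * \<beta> - \<kappa> * p" and cu: "c \<bullet> u = (\<kappa> - 1) * X - \<kappa> * A"
    by (simp_all add: y c inner_diff_left abbrev xa)
  define e f where "e = 2 * (A - \<mu> * t)" and "f = 2 * (X - \<mu> * t)"
  have a1: "transport_lift \<mu> a z = (e *\<^sub>R a + (\<mu>\<^sup>2 - \<alpha>) *\<^sub>R u, (\<alpha> + \<mu>\<^sup>2) * t - 2 * \<mu> * A)"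
    and x1: "transport_lift \<mu> x z = (f *\<^sub>R x + (\<mu>\<^sup>2 - \<beta>) *\<^sub>R u, (\<beta> + \<mu>\<^sup>2) * t - 2 * \<mu> * X)"
    by (simp_all add: transport_lift_def z abbrev e_def f_def)
  define g h where "g = e * (y \<bullet> a) + (\<mu>\<^sup>2 - \<alpha>) * (y \<bullet> u)"
    and "h = f * (c \<bullet> x) + (\<mu>\<^sup>2 - \<beta>) * (c \<bullet> u)"
  define m n where "m = 2 * (g - \<mu> * ((\<alpha> + \<mu>\<^sup>2) * t - 2 * \<mu> * A))"
    and "n = 2 * (h - \<mu> * ((\<beta> + \<mu>\<^sup>2) * t - 2 * \<mu> * X))"
  have a2: "transport_lift \<mu> y (transport_lift \<mu> a z) =
      (m *\<^sub>R y + (\<mu>\<^sup>2 - \<beta>) *\<^sub>R (e *\<^sub>R a + (\<mu>\<^sup>2 - \<alpha>) *\<^sub>R u),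
       (\<beta> + \<mu>\<^sup>2) * ((\<alpha> + \<mu>\<^sup>2) * t - 2 * \<mu> * A) - 2 * \<mu> * g)"
    unfolding a1 by (simp add: transport_lift_def yy m_def g_def inner_add_right)
  have x2: "transport_lift \<mu> c (transport_lift \<mu> x z) =
      (n *\<^sub>R c + (\<mu>\<^sup>2 - \<alpha>) *\<^sub>R (f *\<^sub>R x + (\<mu>\<^sup>2 - \<beta>) *\<^sub>R u),
       (\<alpha> + \<mu>\<^sup>2) * ((\<beta> + \<mu>\<^sup>2) * t - 2 * \<mu> * X) - 2 * \<mu> * h)"
    unfolding x1 by (simp add: transport_lift_def cc n_def h_def inner_add_right)
  note coeffs = g_def h_def m_def n_def e_def f_def ya yu cx cu
  have coeff_a: "(\<mu>\<^sup>2 - \<beta>) * e - (1 + \<kappa>) * m = - \<kappa> * n"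
    using r unfolding coeffs by algebra
  have coeff_x: "\<kappa> * m = (\<kappa> - 1) * n + (\<mu>\<^sup>2 - \<alpha>) * f"
    using r unfolding coeffs by algebra
  have "m *\<^sub>R y + (\<mu>\<^sup>2 - \<beta>) *\<^sub>R (e *\<^sub>R a + (\<mu>\<^sup>2 - \<alpha>) *\<^sub>R u) =
      ((\<mu>\<^sup>2 - \<beta>) * e - (1 + \<kappa>) * m) *\<^sub>R a + (\<kappa> * m) *\<^sub>R x + ((\<mu>\<^sup>2 - \<beta>) * (\<mu>\<^sup>2 - \<alpha>)) *\<^sub>R u"
    by (simp add: y algebra_simps)
  also have "\<dots> = n *\<^sub>R c + (\<mu>\<^sup>2 - \<alpha>) *\<^sub>R (f *\<^sub>R x + (\<mu>\<^sup>2 - \<beta>) *\<^sub>R u)"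
    unfolding coeff_a coeff_x by (simp add: c algebra_simps)
  moreover have "(\<beta> + \<mu>\<^sup>2) * ((\<alpha> + \<mu>\<^sup>2) * t - 2 * \<mu> * A) - 2 * \<mu> * g =
      (\<alpha> + \<mu>\<^sup>2) * ((\<beta> + \<mu>\<^sup>2) * t - 2 * \<mu> * X) - 2 * \<mu> * h"
    using r unfolding coeffs by algebra
  ultimately show ?thesis unfolding a2 x2 by simp
qed

text \<open>
  Transport folds the parallelogram with vertices \<open>P\<close>, \<open>Q\<close>, \<open>X + Q - P\<close>, \<open>X\<close> along its diagonal
  \<open>X Q\<close>.  Therefore the new diagonal from \<open>P\<close> to \<open>Y\<close> is parallel to \<open>X - Q\<close>, and \<open>\<kappa>\<close> is the ratio.
\<close>

lemma bicycle_transport_sides: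
  fixes P Q X :: "'a::real_inner"
  assumes "Q \<noteq> X"
  defines "Y \<equiv> bicycle_transport P Q X"
  defines "a \<equiv> Q - P" and "x \<equiv> X - P"
  obtains \<kappa> where "\<kappa> * (a \<bullet> a + x \<bullet> x - 2 * (a \<bullet> x)) = x \<bullet> x - a \<bullet> a"
    and "Y - Q = \<kappa> *\<^sub>R x - (1 + \<kappa>) *\<^sub>R a" and "Y - X = (\<kappa> - 1) *\<^sub>R x - \<kappa> *\<^sub>R a"
proof -
  define D where "D = (norm (a - x))\<^sup>2"
  define q where "q = 2 * (a \<bullet> (a - x)) / D"
  have D0: "D \<noteq> 0" using assms by (simp add: D_def)
  have D: "D = a \<bullet> a + x \<bullet> x - 2 * (a \<bullet> x)"
    by (simp add: D_def power2_norm_eq_inner inner_diff_left inner_diff_right inner_commute)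
  have "Q - X = a - x" "X + Q - P - X = a" by (simp_all add: a_def x_def)
  then have "Y = X + q *\<^sub>R (a - x) - a"
    by (simp add: Y_def bicycle_transport_def line_reflection_def q_def D_def)
  then have YX: "Y - X = q *\<^sub>R (a - x) - a" by simp
  have "Y - Q = Y - X + x - a" by (simp add: a_def x_def)
  then have YQ: "Y - Q = q *\<^sub>R (a - x) - a + x - a" by (simp only: YX)
  have "q * D = 2 * (a \<bullet> a) - 2 * (a \<bullet> x)" using D0 by (simp add: q_def inner_diff_right)
  moreover have "(1 - q) * D = D - q * D" by (simp add: left_diff_distrib)
  ultimately have "(1 - q) * (a \<bullet> a + x \<bullet> x - 2 * (a \<bullet> x)) = x \<bullet> x - a \<bullet> a"
    using D by simp
  then show ?thesis
    by (rule that[of "1 - q"]) (simp_all add: YX YQ algebra_simps scaleR_2)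
qed

text \<open>
  The products of lifts along the two routes agree, and each is a multiple of a pair with last
  coordinate 1 whose first component is the transported vector.  Comparing last coordinates gives
  equal factors; since \<open>\<mu>\<close> differs from the side lengths, these factors are nonzero and cancel.
\<close>

lemma transport_map_commuting_square:
  fixes P Q X :: "'a::real_inner"
  assumes u: "norm u = 1" and \<mu>: "\<mu> > 0"
    and Y: "Y = bicycle_transport P Q X" and "Q \<noteq> X"
    and "dist P Q \<noteq> \<mu>" "dist X Y \<noteq> \<mu>" "dist P X \<noteq> \<mu>" "dist Q Y \<noteq> \<mu>"
  shows "transport_map Q Y \<mu> (transport_map P Q \<mu> u) = transport_map X Y \<mu> (transport_map P X \<mu> u)"
proof -
  obtain \<kappa> where \<kappa>: "\<kappa> * ((Q - P) \<bullet> (Q - P) + (X - P) \<bullet> (X - P) - 2 * ((Q - P) \<bullet> (X - P)))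
        = (X - P) \<bullet> (X - P) - (Q - P) \<bullet> (Q - P)"
      "Y - Q = \<kappa> *\<^sub>R (X - P) - (1 + \<kappa>) *\<^sub>R (Q - P)" "Y - X = (\<kappa> - 1) *\<^sub>R (X - P) - \<kappa> *\<^sub>R (Q - P)"
    using bicycle_transport_sides[OF \<open>Q \<noteq> X\<close>, of P] unfolding Y by blast
  have two_steps: "\<exists>r. r \<noteq> 0 \<and> transport_lift \<mu> (Y - R) (transport_lift \<mu> (R - P) (u, 1)) =
      r *\<^sub>R (transport_map R Y \<mu> (transport_map P R \<mu> u), 1)"
    if "dist P R \<noteq> \<mu>" "dist R Y \<noteq> \<mu>" for R
  proof -
    define v where "v = transport_map P R \<mu> u"
    have v: "norm v = 1" using u by (simp add: v_def norm_transport_map)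
    have "norm (R - P) \<noteq> \<mu>" "norm (Y - R) \<noteq> \<mu>"
      using that by (simp_all add: dist_norm norm_minus_commute)
    then have "(norm ((R - P) - \<mu> *\<^sub>R u))\<^sup>2 * (norm ((Y - R) - \<mu> *\<^sub>R v))\<^sup>2 \<noteq> 0"
      using transport_denominator_nonzero[OF u \<mu>] transport_denominator_nonzero[OF v \<mu>]
      unfolding mult_eq_0_iff by blast
    moreover have "transport_lift \<mu> (Y - R) (transport_lift \<mu> (R - P) (u, 1)) =
        ((norm ((R - P) - \<mu> *\<^sub>R u))\<^sup>2 * (norm ((Y - R) - \<mu> *\<^sub>R v))\<^sup>2) *\<^sub>R (transport_map R Y \<mu> v, 1)"
      by (simp only: transport_lift_eq[OF u \<mu> that(1)] transport_lift_eq[OF v \<mu> that(2)]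
          transport_lift_scaleR scaleR_scaleR flip: v_def)
    ultimately show ?thesis unfolding v_def by blast
  qed
  obtain r s where "r \<noteq> 0" and
    "transport_lift \<mu> (Y - Q) (transport_lift \<mu> (Q - P) (u, 1)) =
      r *\<^sub>R (transport_map Q Y \<mu> (transport_map P Q \<mu> u), 1)"
    "transport_lift \<mu> (Y - X) (transport_lift \<mu> (X - P) (u, 1)) =
      s *\<^sub>R (transport_map X Y \<mu> (transport_map P X \<mu> u), 1)"
    using two_steps[of Q] two_steps[of X] assms by blast
  then show ?thesis
    using transport_lift_butterfly[OF \<kappa>, of \<mu> "(u, 1)"]
    by (metis Pair_inject mult.right_neutral real_scaleR_def scaleR_Pair
        scaleR_left_imp_eq)
qed

lemma iterated_transport_intertwine:
  fixes V W :: "nat \<Rightarrow> 'a::real_inner"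
  assumes VW: "bicycle_correspondence l V W" and lV: "differs_from_sides l V"
    and \<mu>: "\<mu> > 0" and \<mu>V: "differs_from_sides \<mu> V" and \<mu>W: "differs_from_sides \<mu> W"
    and "\<mu> \<noteq> l" and u: "norm u = 1"
  shows "iterated_transport W \<mu> j (transport_map (V 1) (W 1) \<mu> u) =
    transport_map (V (Suc j)) (W (Suc j)) \<mu> (iterated_transport V \<mu> j u)"
proof (induction j)
  case (Suc j)
  have norm_iter: "norm (iterated_transport V \<mu> j u) = 1" for j
    by (induction j) (simp_all add: u norm_transport_map)
  have d: "dist (V i) (W i) = l" "W (Suc i) = bicycle_transport (V i) (V (Suc i)) (W i)" for i
    using VW by (auto simp: bicycle_correspondence_def)
  have "V (Suc i) \<noteq> W i" for i using d(1)[of i] lV by (metis differs_from_sides_def)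
  moreover have "dist (V i) (W i) \<noteq> \<mu>" "dist (V i) (V (Suc i)) \<noteq> \<mu>" "dist (W i) (W (Suc i)) \<noteq> \<mu>" for i
    using d(1) \<mu>V \<mu>W \<open>\<mu> \<noteq> l\<close> by (metis differs_from_sides_def)+
  ultimately have "transport_map (V (Suc i)) (W (Suc i)) \<mu> (transport_map (V i) (V (Suc i)) \<mu> v) =
      transport_map (W i) (W (Suc i)) \<mu> (transport_map (V i) (W i) \<mu> v)" if "norm v = 1" for i v
    by (intro transport_map_commuting_square[OF that \<mu> d(2)])
  then show ?case using Suc norm_iter by simp
qed simp

section \<open>Transports are Moebius transformations\<close>

lemma moebius_carrier_Bij: "carrier moebius_group \<subseteq> Bij (sphere (0::'a::real_inner) 1)"
proof -
  interpret group "BijGroup (sphere (0::'a) 1)" by (rule group_BijGroup)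
  have "sphere_inversions \<subseteq> carrier (BijGroup (sphere (0::'a) 1))"
    using sphere_inversions_subset_Bij by (simp add: BijGroup_def)
  then show ?thesis
    using generate_incl by (simp add: moebius_group_def BijGroup_def)
qed

lemma restrict_moebius_mult:
  fixes f g :: "'a::real_inner \<Rightarrow> 'a"
  defines "S \<equiv> sphere (0::'a) 1"
  assumes f: "restrict f S \<in> carrier moebius_group" and g: "restrict g S \<in> carrier moebius_group"
  shows "restrict f S \<otimes>\<^bsub>moebius_group\<^esub> restrict g S = restrict (f \<circ> g) S"
proof -
  have B: "restrict f S \<in> Bij S" "restrict g S \<in> Bij S"
    using f g moebius_carrier_Bij by (auto simp: S_def)
  then have "g u \<in> S" if "u \<in> S" for u
    using that by (auto simp: Bij_def bij_betw_def)
  moreover have "restrict f S \<otimes>\<^bsub>moebius_group\<^esub> restrict g S = compose S (restrict f S) (restrict g S)"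
    using B by (simp add: moebius_group_def BijGroup_def flip: S_def)
  ultimately show ?thesis by (auto simp: compose_def fun_eq_iff)
qed

lemma moebius_comp:
  fixes f g :: "'a::real_inner \<Rightarrow> 'a"
  assumes "restrict f (sphere 0 1) \<in> carrier moebius_group"
    and "restrict g (sphere 0 1) \<in> carrier moebius_group"
  shows "restrict (f \<circ> g) (sphere 0 1) \<in> carrier moebius_group"
proof -
  interpret group "moebius_group :: ('a \<Rightarrow> 'a) monoid" by (rule group_moebius_group)
  show ?thesis using m_closed[OF assms] restrict_moebius_mult[OF assms] by simp
qed

lemma restrict_id_moebius:
  "restrict (\<lambda>u. u) (sphere (0::'a::real_inner) 1) \<in> carrier moebius_group"
proof -
  interpret group "moebius_group :: ('a \<Rightarrow> 'a) monoid" by (rule group_moebius_group)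
  have "\<one>\<^bsub>moebius_group\<^esub> = restrict (\<lambda>u. u) (sphere (0::'a) 1)"
    by (simp add: moebius_group_def BijGroup_def)
  then show ?thesis using one_closed by simp
qed

lemma sphere_inversions_moebius: "sphere_inversions \<subseteq> carrier moebius_group"
  by (auto simp: moebius_group_def intro: generate.incl)

text \<open>The radius makes the sphere of inversion orthogonal to the unit sphere.\<close>

lemma inversion_moebius:
  assumes "norm c > 1"
  shows "restrict (inversion c (sqrt ((norm c)\<^sup>2 - 1))) (sphere 0 1) \<in> carrier moebius_group"
proof -
  have "(norm c)\<^sup>2 > 1" using assms by (simp add: power_strict_mono one_less_power)
  then show ?thesis
    by (intro subsetD[OF sphere_inversions_moebius])
       (auto simp: sphere_inversions_def intro!: exI[of _ c] exI[of _ "sqrt ((norm c)\<^sup>2 - 1)"])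
qed

lemma hyperplane_reflection_moebius:
  "a \<noteq> 0 \<Longrightarrow> restrict (hyperplane_reflection a) (sphere 0 1) \<in> carrier moebius_group"
  by (intro subsetD[OF sphere_inversions_moebius]) (auto simp: sphere_inversions_def)

text \<open>Reflecting in the coordinate hyperplanes one after the other changes all signs.\<close>

lemma antipodal_moebius:
  "restrict uminus (sphere (0::'a::euclidean_space) 1) \<in> carrier moebius_group"
proof -
  have partial: "restrict (\<lambda>u. u - 2 *\<^sub>R (\<Sum>b\<in>F. (u \<bullet> b) *\<^sub>R b)) (sphere (0::'a) 1) \<in> carrier moebius_group"
    if "finite F" "F \<subseteq> Basis" for F
    using that
  proof (induction F rule: finite_induct)
    case empty
    have "(\<lambda>u::'a. u - 2 *\<^sub>R (\<Sum>b\<in>{}. (u \<bullet> b) *\<^sub>R b)) = (\<lambda>u. u)" by simp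
    then show ?case using restrict_id_moebius by metis
  next
    case (insert b F)
    let ?f = "\<lambda>F (u::'a). u - 2 *\<^sub>R (\<Sum>b\<in>F. (u \<bullet> b) *\<^sub>R b)"
    have b: "b \<in> Basis" using insert.prems by simp
    have "c \<bullet> b = 0" if "c \<in> F" for c
      using that insert b by (intro inner_not_same_Basis) auto
    then have "?f F u \<bullet> b = u \<bullet> b" for u by (simp add: inner_diff_left inner_sum_left)
    then have "?f (insert b F) = hyperplane_reflection b \<circ> ?f F"
      using insert.hyps b by (simp add: fun_eq_iff hyperplane_reflection_def algebra_simps)
    moreover have "restrict (?f F) (sphere 0 1) \<in> carrier moebius_group"
      using insert.prems by (intro insert.IH) simp
    then have "restrict (hyperplane_reflection b \<circ> ?f F) (sphere 0 1) \<in> carrier moebius_group"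
      by (rule moebius_comp[OF hyperplane_reflection_moebius[OF nonzero_Basis[OF b]]])
    ultimately show ?case by (simp only:)
  qed
  have "(\<lambda>u. u - 2 *\<^sub>R (\<Sum>b\<in>Basis. (u \<bullet> b) *\<^sub>R b)) = (uminus :: 'a \<Rightarrow> 'a)"
    by (simp add: fun_eq_iff euclidean_representation scaleR_2)
  then show ?thesis using partial[of Basis] by simp
qed

lemma inversion_on_sphere:
  assumes u: "norm u = 1" and c: "norm c > 1"
  shows "inversion c (sqrt ((norm c)\<^sup>2 - 1)) u =
    (1 / (1 + c \<bullet> c - 2 * (c \<bullet> u))) *\<^sub>R ((2 * (1 - c \<bullet> u)) *\<^sub>R c + (c \<bullet> c - 1) *\<^sub>R u)"
proof -
  define D where "D = 1 + c \<bullet> c - 2 * (c \<bullet> u)"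
  have "(norm c)\<^sup>2 > 1" using c by (simp add: one_less_power)
  moreover have "(norm (u - c))\<^sup>2 = D"
    using u by (simp add: D_def power2_norm_eq_inner norm_eq_1 inner_diff_left inner_diff_right inner_commute)
  moreover have "D \<noteq> 0" using calculation u c by auto
  ultimately have "inversion c (sqrt ((norm c)\<^sup>2 - 1)) u = (1 / D) *\<^sub>R (D *\<^sub>R c + (c \<bullet> c - 1) *\<^sub>R (u - c))"
    by (simp add: inversion_def power_divide power2_norm_eq_inner scaleR_add_right)
  also have "D *\<^sub>R c + (c \<bullet> c - 1) *\<^sub>R (u - c) = (2 * (1 - c \<bullet> u)) *\<^sub>R c + (c \<bullet> c - 1) *\<^sub>R u"
    by (simp add: D_def algebra_simps scaleR_2)
  finally show ?thesis by (simp add: D_def)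
qed

text \<open>
  Transport depends on \<open>P\<close>, \<open>Q\<close> and \<open>\<mu>\<close> only through \<open>c\<close>, and in this form it is visibly the
  negative of the formula for the inversion centred at \<open>c\<close>.
\<close>

lemma transport_map_rescaled:
  fixes u :: "'a::real_inner"
  assumes u: "norm u = 1" and \<mu>: "\<mu> > 0" and d: "dist P Q \<noteq> \<mu>" and c: "c = (1 / \<mu>) *\<^sub>R (Q - P)"
  shows "transport_map P Q \<mu> u =
    (1 / (1 + c \<bullet> c - 2 * (c \<bullet> u))) *\<^sub>R ((2 * (c \<bullet> u - 1)) *\<^sub>R c + (1 - c \<bullet> c) *\<^sub>R u)"
    and "1 + c \<bullet> c - 2 * (c \<bullet> u) \<noteq> 0"
proof -
  define D where "D = 1 + c \<bullet> c - 2 * (c \<bullet> u)"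
  define E where "E = (norm ((Q - P) - \<mu> *\<^sub>R u))\<^sup>2"
  have a: "Q - P = \<mu> *\<^sub>R c" using \<mu> c by simp
  have ED: "E = \<mu>\<^sup>2 * D"
    unfolding E_def transport_denominator_expand[OF u]
    by (simp add: a D_def power2_eq_square algebra_simps)
  have "E \<noteq> 0" unfolding E_def
    using u \<mu> d by (intro transport_denominator_nonzero) (auto simp: dist_norm norm_minus_commute)
  then have D: "D \<noteq> 0" using ED by auto
  then show "1 + c \<bullet> c - 2 * (c \<bullet> u) \<noteq> 0" by (simp add: D_def)
  have "(\<mu>\<^sup>2 * D) *\<^sub>R transport_map P Q \<mu> u = \<mu>\<^sup>2 *\<^sub>R ((2 * (c \<bullet> u - 1)) *\<^sub>R c + (1 - c \<bullet> c) *\<^sub>R u)"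
    using arg_cong[OF transport_lift_eq[OF u \<mu> d], of fst]
    unfolding E_def[symmetric] ED
    by (simp add: transport_lift_def a power2_eq_square algebra_simps)
  then have "D *\<^sub>R transport_map P Q \<mu> u = (2 * (c \<bullet> u - 1)) *\<^sub>R c + (1 - c \<bullet> c) *\<^sub>R u"
    using \<mu> by (simp flip: scaleR_scaleR)
  then have "(1 / D) *\<^sub>R (D *\<^sub>R transport_map P Q \<mu> u) =
      (1 / D) *\<^sub>R ((2 * (c \<bullet> u - 1)) *\<^sub>R c + (1 - c \<bullet> c) *\<^sub>R u)" by simp
  then show "transport_map P Q \<mu> u =
    (1 / (1 + c \<bullet> c - 2 * (c \<bullet> u))) *\<^sub>R ((2 * (c \<bullet> u - 1)) *\<^sub>R c + (1 - c \<bullet> c) *\<^sub>R u)"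
    using D by (simp flip: D_def)
qed

text \<open>
  A sphere orthogonal to the unit sphere has its centre outside, so for \<open>norm c < 1\<close> there is no
  inversion centred at \<open>c\<close>; the inverse point \<open>b\<close> takes the place of \<open>c\<close>.  Replacing \<open>c\<close> by \<open>b\<close>
  in the formula for the inversion composes it with the antipodal map and with the reflection in
  the hyperplane orthogonal to \<open>c\<close>, and the antipodal map cancels the sign in the transport.
\<close>

lemma transport_map_moebius:
  fixes P Q :: "'a::euclidean_space"
  assumes \<mu>: "\<mu> > 0" and d: "dist P Q \<noteq> \<mu>"
  shows "restrict (transport_map P Q \<mu>) (sphere 0 1) \<in> carrier moebius_group"
proof -
  define c where "c = (1 / \<mu>) *\<^sub>R (Q - P)"
  note T = transport_map_rescaled[OF _ \<mu> d c_def]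
  have "norm c = dist P Q / \<mu>"
    using \<mu> by (simp add: c_def dist_norm norm_minus_commute)
  then have "norm c \<noteq> 1" using \<mu> d by auto
  then consider "c = 0" | "norm c > 1" | "c \<noteq> 0" "norm c < 1" by fastforce
  then show ?thesis
  proof cases
    case 1
    then have "restrict (transport_map P Q \<mu>) (sphere 0 1) = restrict (\<lambda>u. u) (sphere 0 1)"
      using T(1) by (intro restrict_ext) simp
    then show ?thesis using restrict_id_moebius by metis
  next
    case 2
    have "transport_map P Q \<mu> u = (uminus \<circ> inversion c (sqrt ((norm c)\<^sup>2 - 1))) u"
      if "norm u = 1" for u
      unfolding T(1)[OF that] o_apply inversion_on_sphere[OF that 2]
      by (simp add: algebra_simps)
    then have "restrict (transport_map P Q \<mu>) (sphere 0 1) =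
        restrict (uminus \<circ> inversion c (sqrt ((norm c)\<^sup>2 - 1))) (sphere 0 1)"
      by (intro restrict_ext) simp
    then show ?thesis
      using moebius_comp[OF antipodal_moebius inversion_moebius[OF 2]] by metis
  next
    case 3
    define b where "b = (1 / (c \<bullet> c)) *\<^sub>R c"
    have cc: "c \<bullet> c \<noteq> 0" using 3 by simp
    have "norm b = 1 / norm c"
      using 3 by (simp add: b_def power2_eq_square flip: power2_norm_eq_inner)
    then have b: "norm b > 1" using 3 by simp
    have "transport_map P Q \<mu> u = (hyperplane_reflection c \<circ> inversion b (sqrt ((norm b)\<^sup>2 - 1))) u"
      if u: "norm u = 1" for u
    proof -
      define s q where "s = c \<bullet> c" and "q = c \<bullet> u"
      define D where "D = 1 + s - 2 * q"
      have s0: "s \<noteq> 0" and D0: "D \<noteq> 0" using cc T(2)[OF u] by (simp_all add: s_def D_def q_def)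
      define w where "w = (2 * (s - q) / s) *\<^sub>R c + (1 - s) *\<^sub>R u"
      have bb: "b \<bullet> b = 1 / s" and bu: "b \<bullet> u = q / s"
        using s0 by (simp_all add: b_def s_def q_def)
      have "1 + b \<bullet> b - 2 * (b \<bullet> u) = D / s"
        using s0 by (simp add: bb bu D_def field_simps)
      moreover have "(2 * (1 - b \<bullet> u)) *\<^sub>R b + (b \<bullet> b - 1) *\<^sub>R u = (1 / s) *\<^sub>R w"
        unfolding bb bu w_def using s0
        by (simp add: b_def scaleR_add_right diff_divide_distrib flip: s_def)
      ultimately have "inversion b (sqrt ((norm b)\<^sup>2 - 1)) u = (1 / D) *\<^sub>R w"
        unfolding inversion_on_sphere[OF u b] using s0 by simp
      moreover have "w \<bullet> c = 2 * (s - q) + (1 - s) * q"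
        unfolding w_def using s0
        by (simp add: inner_add_left inner_commute[of u c] flip: s_def q_def)
      then have "hyperplane_reflection c ((1 / D) *\<^sub>R w) =
          (1 / D) *\<^sub>R (w - (2 * (2 * (s - q) + (1 - s) * q) / s) *\<^sub>R c)"
        by (simp add: hyperplane_reflection_def power2_norm_eq_inner scaleR_diff_right flip: s_def)
      moreover have "2 * (s - q) / s - 2 * (2 * (s - q) + (1 - s) * q) / s = 2 * (q - 1)"
        using s0 by (simp add: field_simps)
      then have "w - (2 * (2 * (s - q) + (1 - s) * q) / s) *\<^sub>R c = (2 * (q - 1)) *\<^sub>R c + (1 - s) *\<^sub>R u"
        unfolding w_def by (metis add_diff_eq diff_add_eq scaleR_left.diff)
      ultimately show ?thesis
        by (simp add: T(1)[OF u] flip: s_def q_def D_def)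
    qed
    then have "restrict (transport_map P Q \<mu>) (sphere 0 1) =
        restrict (hyperplane_reflection c \<circ> inversion b (sqrt ((norm b)\<^sup>2 - 1))) (sphere 0 1)"
      by (intro restrict_ext) simp
    then show ?thesis
      using moebius_comp[OF hyperplane_reflection_moebius inversion_moebius[OF b]] 3 by metis
  qed
qed

lemma bicycle_monodromy_moebius:
  fixes V :: "nat \<Rightarrow> 'a::euclidean_space"
  assumes "\<mu> > 0" and "differs_from_sides \<mu> V"
  shows "bicycle_monodromy k V \<mu> \<in> carrier moebius_group"
proof -
  have "restrict (iterated_transport V \<mu> j) (sphere 0 1) \<in> carrier moebius_group" for j
  proof (induction j)
    case 0
    have "iterated_transport V \<mu> 0 = (\<lambda>u. u)" by (simp add: id_def)
    then show ?case using restrict_id_moebius by metis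
  next
    case (Suc j)
    have "dist (V (Suc j)) (V (Suc (Suc j))) \<noteq> \<mu>"
      using assms(2) by (metis differs_from_sides_def)
    then show ?case
      using Suc assms(1) by (simp only: iterated_transport.simps) (intro moebius_comp transport_map_moebius)
  qed
  then show ?thesis by (simp add: bicycle_monodromy_def)
qed

section \<open>Conjugacy of the monodromies\<close>

theorem theorem2:
  fixes V W :: "nat \<Rightarrow> real ^ 'n" and k :: nat and l \<mu> :: real
  assumes "CARD('n) \<ge> 2"
    and "closed_polygon k V" and "closed_polygon k W"
    and "l > 0" and "differs_from_sides l V" and "differs_from_sides l W"
    and "bicycle_correspondence l V W"
    and "\<mu> > 0" and "differs_from_sides \<mu> V" and "differs_from_sides \<mu> W"
    and "\<mu> \<noteq> l"
  shows "conjugate_in moebius_group (bicycle_monodromy k V \<mu>) (bicycle_monodromy k W \<mu>)"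
proof -
  let ?S = "sphere (0 :: real ^ 'n) 1" and ?M = "moebius_group :: (real ^ 'n \<Rightarrow> real ^ 'n) monoid"
  interpret group ?M by (rule group_moebius_group)
  define h where "h = transport_map (V 1) (W 1) \<mu>"
  let ?h = "restrict h ?S"
  have hM: "?h \<in> carrier ?M"
    unfolding h_def using assms(7,8,11)
    by (intro transport_map_moebius) (simp_all add: bicycle_correspondence_def del: One_nat_def)
  note VM = bicycle_monodromy_moebius[OF \<open>\<mu> > 0\<close> \<open>differs_from_sides \<mu> V\<close>, of k]
    and WM = bicycle_monodromy_moebius[OF \<open>\<mu> > 0\<close> \<open>differs_from_sides \<mu> W\<close>, of k]
  have "V (1 + k) = V 1" "W (1 + k) = W 1"
    using assms(2,3) unfolding closed_polygon_def by blast+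
  then have "iterated_transport W \<mu> k (h u) = h (iterated_transport V \<mu> k u)" if "norm u = 1" for u
    unfolding h_def
    using iterated_transport_intertwine[OF assms(7,5,8,9,10,11) that, of k] by simp
  then have "restrict (iterated_transport W \<mu> k \<circ> h) ?S = restrict (h \<circ> iterated_transport V \<mu> k) ?S"
    by (intro restrict_ext) simp
  then have "bicycle_monodromy k W \<mu> \<otimes>\<^bsub>?M\<^esub> ?h = ?h \<otimes>\<^bsub>?M\<^esub> bicycle_monodromy k V \<mu>"
    using hM VM WM unfolding bicycle_monodromy_def by (simp add: restrict_moebius_mult)
  then have "bicycle_monodromy k W \<mu> = ?h \<otimes>\<^bsub>?M\<^esub> bicycle_monodromy k V \<mu> \<otimes>\<^bsub>?M\<^esub> inv\<^bsub>?M\<^esub> ?h"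
    using hM VM WM by (simp add: inv_solve_right)
  then show ?thesis
    unfolding conjugate_in_def using hM VM WM by blast
qed

end
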